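(* Let $0\le a_1\le\cdots\le a_n$ and $0\le b_1\le\cdots\le b_n$ be real numbers, and put $$g(s)=\frac1{s^2}\sum_{k=1}^n\left(e^{-sa_k}-e^{-sb_k}\right)\quad(s>0),\qquad \rho(t)=\sum_{k=1}^n (t-a_k)\mathbf 1_{[a_k,\infty)}(t)-\sum_{k=1}^n (t-b_k)\mathbf 1_{[b_k,\infty)}(t).$$ Then $g$ is the Laplace transform of $\rho$: $g(s)=\int_0^\infty e^{-st}\rho(t)\,dt$ for all $s>0$. Moreover, $g$ is completely monotonic if and only if $\rho$ is non-negative, which is the case exactly when $(b_k)_{k=1}^n\prec_w(a_k)_{k=1}^n$.
   Context: $\mathbf 1_S$ is the indicator function of $S$. Weak supermajorisation: for sequences in non-decreasing order, $b\prec_w a$ means $\sum_{k=1}^m a_k\le\sum_{k=1}^m b_k$ for all $m\in\{1,\ldots,n\}$. A function $\varphi\in C^\infty((0,\infty))$ is completely monotonic if $(-1)^j\varphi^{(j)}(x)\ge0$ for all $j=0,1,2,\ldots$ and all $x>0$. *)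

theory Defs
  imports "HOL-Analysis.Analysis"
begin

text \<open>
  Finite sequences are functions \<open>nat \<Rightarrow> real\<close> of which only the values at the indices
  \<open>1, \<dots>, n\<close> matter.
\<close>

definition g_fun :: "nat \<Rightarrow> (nat \<Rightarrow> real) \<Rightarrow> (nat \<Rightarrow> real) \<Rightarrow> real \<Rightarrow> real" where
  "g_fun n a b s = 1 / s\<^sup>2 * (\<Sum>k=1..n. exp (- s * a k) - exp (- s * b k))"

definition rho_fun :: "nat \<Rightarrow> (nat \<Rightarrow> real) \<Rightarrow> (nat \<Rightarrow> real) \<Rightarrow> real \<Rightarrow> real" where
  "rho_fun n a b t =
     (\<Sum>k=1..n. (t - a k) * indicator {a k..} t) - (\<Sum>k=1..n. (t - b k) * indicator {b k..} t)"

text \<open>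
  The first conjunct says that \<open>\<phi>\<close> is smooth on the positive half-line. As this half-line is
  open, the values of the iterated derivatives there do not depend on \<open>\<phi>\<close> outside it.
\<close>

definition completely_monotonic :: "(real \<Rightarrow> real) \<Rightarrow> bool" where
  "completely_monotonic \<phi> \<longleftrightarrow>
     (\<forall>j. \<forall>x>0. (deriv ^^ j) \<phi> differentiable (at x)) \<and>
     (\<forall>j. \<forall>x>0. (-1) ^ j * (deriv ^^ j) \<phi> x \<ge> 0)"

text \<open>
  \<open>weakly_supermajorized n b a\<close> stands for \<open>b \<prec>\<^sub>w a\<close>. It is meant only for sequences that
  are already in non-decreasing order; no rearrangement is performed.
\<close>

definition weakly_supermajorized :: "nat \<Rightarrow> (nat \<Rightarrow> real) \<Rightarrow> (nat \<Rightarrow> real) \<Rightarrow> bool" where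
  "weakly_supermajorized n b a \<longleftrightarrow> (\<forall>m\<in>{1..n}. (\<Sum>k=1..m. a k) \<le> (\<Sum>k=1..m. b k))"

end

theory Submission
  imports Defs "HOL-Probability.Distributions"
begin

text \<open>
  The function \<open>\<rho>\<close> is a difference of sums of hinges \<open>t \<mapsto> max 0 (t - c)\<close>, and the Laplace transform
  of such a hinge is \<open>exp (- s c) / s\<^sup>2\<close>; this gives the integral formula for \<open>g\<close>.

  Differentiating under the integral sign, \<open>(-1)\<^sup>j g\<^sup>(\<^sup>j\<^sup>)(s)\<close> is the integral of \<open>t\<^sup>j exp (- s t) \<rho>(t)\<close>
  (\<open>laplace_higher_deriv\<close>), so \<open>g\<close> is completely monotonic if \<open>\<rho> \<ge> 0\<close>. The converse is the
  inversion formula of Post and Widder: multiplied by \<open>s\<^sup>k\<^sup>+\<^sup>1 / k!\<close>, the \<open>k\<close>-th of these integrals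
  is the mean of \<open>\<rho>\<close> under the Erlang distribution with shape \<open>k + 1\<close> and rate \<open>s\<close>. For
  \<open>s = (k + 1) / t\<close> that distribution has mean \<open>t\<close> and standard deviation \<open>t / sqrt (k + 1)\<close>. As
  \<open>\<rho>\<close> is Lipschitz, the mean of \<open>\<rho>\<close> converges to \<open>\<rho>(t)\<close> for \<open>k \<rightarrow> \<infinity>\<close>
  (\<open>erlang_average_lipschitz\<close>), and a limit of non-negative numbers is non-negative.

  Finally, for a sequence \<open>x\<close> in non-decreasing order, the sum of the hinges at \<open>t\<close> is the largest of
  the sums of \<open>t - x\<^sub>k\<close> over the prefixes \<open>k \<le> m\<close>, attained where the prefix consists of the entries
  below \<open>t\<close>. Comparing these maxima for \<open>a\<close> and \<open>b\<close> turns prefix inequalities into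
  \<open>\<rho> \<ge> 0\<close>, and back by the choice \<open>t = a\<^sub>m\<close> (\<open>rho_fun_nonneg_iff\<close>).
\<close>

section \<open>The Laplace transform of a sum of hinges\<close>

lemma erlang_density_moment:
  assumes "0 < l"
  shows "has_bochner_integral lborel (\<lambda>x. erlang_density k l x * x ^ i) (fact (k + i) / (fact k * l ^ i))"
proof (rule has_bochner_integral_nn_integral)
  show "AE x in lborel. 0 \<le> erlang_density k l x * x ^ i"
    using assms by (auto simp: erlang_density_def)
  show "(\<integral>\<^sup>+ x. ennreal (erlang_density k l x * x ^ i) \<partial>lborel) = ennreal (fact (k + i) / (fact k * l ^ i))"
    using nn_integral_erlang_ith_moment[OF assms, of k i] by simp
qed (use assms in auto)

text \<open>
  The Erlang density of shape 2 and rate \<open>s\<close> is \<open>s\<^sup>2 t exp (- s t)\<close> for \<open>t \<ge> 0\<close>, so shifting it by \<open>c\<close> gives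
  the integrand up to a constant factor.
\<close>
lemma hinge_laplace:
  fixes c s :: real
  assumes "0 \<le> c" "0 < s"
  shows "has_bochner_integral lborel
    (\<lambda>t. indicator {0..} t *\<^sub>R (exp (- s * t) * ((t - c) * indicator {c..} t))) (exp (- s * c) / s\<^sup>2)"
proof -
  have "has_bochner_integral lborel (\<lambda>x. erlang_density 1 s x) 1"
    using erlang_density_moment[OF assms(2), of 1 0] by simp
  then have "has_bochner_integral lborel (\<lambda>t. erlang_density 1 s (- c + 1 * t)) 1"
    using lborel_has_bochner_integral_real_affine_iff[of 1 "erlang_density 1 s" 1 "- c"] by simp
  from has_bochner_integral_mult_right[OF this, of "exp (- s * c) / s\<^sup>2"]
  have "has_bochner_integral lborel (\<lambda>t. exp (- s * c) / s\<^sup>2 * erlang_density 1 s (t - c)) (exp (- s * c) / s\<^sup>2)"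
    by simp
  moreover have "exp (- s * c) / s\<^sup>2 * erlang_density 1 s (t - c)
      = indicator {0..} t *\<^sub>R (exp (- s * t) * ((t - c) * indicator {c..} t))" for t
  proof (cases "c \<le> t")
    case True
    have "exp (- s * c) * exp (- s * (t - c)) = exp (- s * t)"
      by (simp add: exp_add[symmetric] algebra_simps)
    then show ?thesis
      using True assms by (simp add: erlang_density_def power2_eq_square mult_ac)
  next
    case False
    then show ?thesis using assms by (simp add: erlang_density_def)
  qed
  ultimately show ?thesis by (simp only:)
qed

lemma g_fun_has_laplace_integral:
  assumes a: "\<forall>k\<in>{1..n}. 0 \<le> a k" and b: "\<forall>k\<in>{1..n}. 0 \<le> b k" and s: "0 < s"
  shows "has_bochner_integral lborel
    (\<lambda>t. indicator {0..} t *\<^sub>R (exp (- s * t) * rho_fun n a b t)) (g_fun n a b s)"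
proof -
  let ?h = "\<lambda>c t. indicator {0..} t *\<^sub>R (exp (- s * t) * ((t - c) * indicator {c..} t)) :: real"
  have "has_bochner_integral lborel (\<lambda>t. (\<Sum>k=1..n. ?h (a k) t) - (\<Sum>k=1..n. ?h (b k) t))
     ((\<Sum>k=1..n. exp (- s * a k) / s\<^sup>2) - (\<Sum>k=1..n. exp (- s * b k) / s\<^sup>2))"
    using a b s by (intro has_bochner_integral_diff has_bochner_integral_sum hinge_laplace) auto
  moreover have "(\<lambda>t. (\<Sum>k=1..n. ?h (a k) t) - (\<Sum>k=1..n. ?h (b k) t))
     = (\<lambda>t. indicator {0..} t *\<^sub>R (exp (- s * t) * rho_fun n a b t))"
    unfolding rho_fun_def by (simp only: real_scaleR_def right_diff_distrib sum_distrib_left)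
  moreover have "(\<Sum>k=1..n. exp (- s * a k) / s\<^sup>2) - (\<Sum>k=1..n. exp (- s * b k) / s\<^sup>2) = g_fun n a b s"
    unfolding g_fun_def by (simp add: sum_divide_distrib sum_subtractf diff_divide_distrib)
  ultimately show ?thesis by (simp only:)
qed

section \<open>Derivatives of Laplace transforms\<close>

text \<open>
  Up to the sign \<open>(-1)\<^sup>j\<close>, this is the \<open>j\<close>-th derivative of the Laplace transform of \<open>f\<close>.
\<close>
definition laplace_moment :: "(real \<Rightarrow> real) \<Rightarrow> nat \<Rightarrow> real \<Rightarrow> real" where
  "laplace_moment f j s = (LBINT t:{0..}. t ^ j * exp (- s * t) * f t)"

lemma power_le_fact_exp:
  fixes x :: real
  assumes "0 \<le> x"
  shows "x ^ j \<le> fact j * exp x"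
proof -
  have "(\<Sum>i\<in>{j}. x ^ i /\<^sub>R fact i) \<le> exp x"
    unfolding exp_def using assms by (intro sum_le_suminf summable_exp_generic) auto
  then show ?thesis by (simp add: field_simps)
qed

text \<open>
  Half of the exponential decay absorbs the power of \<open>t\<close>; the other half is left for the
  integrability of \<open>f\<close>.
\<close>
lemma laplace_moment_integrable:
  fixes f :: "real \<Rightarrow> real" and s :: real
  assumes f: "\<And>s. 0 < s \<Longrightarrow> set_integrable lborel {0..} (\<lambda>t. exp (- s * t) * f t)"
    and s: "0 < s"
  shows "set_integrable lborel {0..} (\<lambda>t. t ^ j * exp (- s * t) * f t)"
proof (rule set_integrable_bound)
  let ?C = "fact j / (s / 2) ^ j"
  have int: "set_integrable lborel {0..} (\<lambda>t. exp (- (s/2) * t) * f t)"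
    using f[of "s/2"] s by simp
  show "set_integrable lborel {0..} (\<lambda>t. ?C * (exp (- (s/2) * t) * f t))"
    using int by (rule set_integrable_mult_right)
  have "(\<lambda>t. indicator {0..} t *\<^sub>R (exp (- (s/2) * t) * f t)) \<in> borel_measurable lborel"
    using int unfolding set_integrable_def by (rule borel_measurable_integrable)
  then have "(\<lambda>t. t ^ j * exp (- (s/2) * t) * (indicator {0..} t *\<^sub>R (exp (- (s/2) * t) * f t))) \<in> borel_measurable lborel"
    by (intro borel_measurable_times) auto
  moreover have "t ^ j * exp (- (s/2) * t) * (indicator {0..} t *\<^sub>R (exp (- (s/2) * t) * f t))
     = indicator {0..} t *\<^sub>R (t ^ j * exp (- s * t) * f t)" for t
  proof -
    have "exp (- s * t) = exp (- (s/2) * t) * exp (- (s/2) * t)"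
      by (simp add: exp_add[symmetric])
    show ?thesis unfolding \<open>exp (- s * t) = _\<close> by (simp only: real_scaleR_def mult_ac)
  qed
  ultimately show "set_borel_measurable lborel {0..} (\<lambda>t. t ^ j * exp (- s * t) * f t)"
    unfolding set_borel_measurable_def by (simp only:)
  have "norm (t ^ j * exp (- s * t) * f t) \<le> norm (?C * (exp (- (s/2) * t) * f t))" if "0 \<le> t" for t
  proof -
    have "(s/2 * t) ^ j \<le> fact j * exp (s/2 * t)"
      using that s by (intro power_le_fact_exp) auto
    then have "t ^ j \<le> ?C * exp (s/2 * t)"
      using s by (simp add: field_simps power_mult_distrib)
    then have "t ^ j * exp (- s * t) \<le> ?C * exp (s/2 * t) * exp (- s * t)"
      by (intro mult_right_mono) auto
    also have "\<dots> = ?C * exp (- (s/2) * t)"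
      by (simp add: mult.assoc exp_add[symmetric] algebra_simps)
    finally have "t ^ j * exp (- s * t) * \<bar>f t\<bar> \<le> ?C * exp (- (s/2) * t) * \<bar>f t\<bar>"
      by (intro mult_right_mono) auto
    then show ?thesis using that s by (simp add: abs_mult mult.assoc)
  qed
  then show "AE t in lborel. t \<in> {0..} \<longrightarrow> norm (t ^ j * exp (- s * t) * f t) \<le> norm (?C * (exp (- (s/2) * t) * f t))"
    by (intro AE_I2) auto
qed

text \<open>
  A Taylor estimate from convexity alone: the error lies between 0 and \<open>(y - x) (exp y - exp x)\<close>,
  by the tangents of \<open>exp\<close> at \<open>x\<close> and at \<open>y\<close>.
\<close>
lemma exp_first_order_error:
  fixes x y m :: real
  assumes "x \<le> m" "y \<le> m"
  shows "\<bar>exp y - exp x - (y - x) * exp x\<bar> \<le> (y - x)\<^sup>2 * exp m"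
proof -
  have tangent: "(v - u) * exp u \<le> exp v - exp u" for u v :: real
  proof -
    have "exp u * (1 + (v - u)) \<le> exp u * exp (v - u)"
      by (intro mult_left_mono exp_ge_add_one_self) auto
    then show ?thesis by (simp add: exp_diff algebra_simps)
  qed
  have "exp y - exp x - (y - x) * exp x \<le> (y - x) * (exp y - exp x)"
    using tangent[of x y] by (simp add: algebra_simps)
  also have "\<dots> \<le> (y - x)\<^sup>2 * exp m"
  proof (cases "x \<le> y")
    case True
    have "exp y - exp x \<le> (y - x) * exp y"
      using tangent[of x y] by (simp add: algebra_simps)
    also have "\<dots> \<le> (y - x) * exp m" using True assms by (intro mult_left_mono) auto
    finally show ?thesis using True by (simp add: power2_eq_square mult.assoc mult_left_mono)
  next
    case False
    have "exp x - exp y \<le> (x - y) * exp x"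
      using tangent[of y x] by (simp add: algebra_simps)
    also have "\<dots> \<le> (x - y) * exp m" using False assms by (intro mult_left_mono) auto
    finally have "(x - y) * (exp x - exp y) \<le> (x - y) * ((x - y) * exp m)"
      using False by (intro mult_left_mono) auto
    then show ?thesis by (simp add: power2_eq_square algebra_simps)
  qed
  finally show ?thesis using tangent[where u=x and v=y] by simp
qed

text \<open>
  Differentiation under the integral sign: for \<open>u > s/2\<close> the first-order error in \<open>exp (- u t)\<close> is at
  most \<open>(u - s)\<^sup>2 t\<^sup>2 exp (- s t / 2)\<close>, so the first-order error of the integral is at most \<open>(u - s)\<^sup>2\<close>
  times a moment at \<open>s/2\<close>.
\<close>
lemma laplace_moment_deriv:
  assumes f: "\<And>s. 0 < s \<Longrightarrow> set_integrable lborel {0..} (\<lambda>t. exp (- s * t) * f t)"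
    and s: "0 < s"
  shows "(laplace_moment f j has_real_derivative - laplace_moment f (Suc j) s) (at s)"
proof -
  have int: "set_integrable lborel {0..} (\<lambda>t. t ^ i * exp (- u * t) * f t)" if "0 < u" for u i
    using f that by (rule laplace_moment_integrable)
  define K where "K = (LBINT t:{0..}. \<bar>t ^ Suc (Suc j) * exp (- (s/2) * t) * f t\<bar>)"
  have bound: "\<bar>laplace_moment f j u - laplace_moment f j s + (u - s) * laplace_moment f (Suc j) s\<bar> \<le> (u - s)\<^sup>2 * K"
    if u: "s/2 < u" for u
  proof -
    let ?e = "\<lambda>t. t ^ j * exp (- u * t) * f t - t ^ j * exp (- s * t) * f t + (u - s) * (t ^ Suc j * exp (- s * t) * f t)"
    have u0: "0 < u" using u s by simp
    have ie: "set_integrable lborel {0..} ?e"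
      by (intro set_integral_add set_integral_diff set_integrable_mult_right int u0 s)
    have e_eq: "laplace_moment f j u - laplace_moment f j s + (u - s) * laplace_moment f (Suc j) s = (LBINT t:{0..}. ?e t)"
    proof -
      have "(LBINT t:{0..}. ?e t) = (LBINT t:{0..}. t ^ j * exp (- u * t) * f t - t ^ j * exp (- s * t) * f t)
          + (LBINT t:{0..}. (u - s) * (t ^ Suc j * exp (- s * t) * f t))"
        by (intro set_integral_add(2) set_integral_diff(1) set_integrable_mult_right int u0 s)
      moreover have "(LBINT t:{0..}. t ^ j * exp (- u * t) * f t - t ^ j * exp (- s * t) * f t)
          = laplace_moment f j u - laplace_moment f j s"
        unfolding laplace_moment_def by (intro set_integral_diff(2) int u0 s)
      moreover have "(LBINT t:{0..}. (u - s) * (t ^ Suc j * exp (- s * t) * f t)) = (u - s) * laplace_moment f (Suc j) s"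
        unfolding laplace_moment_def by (rule set_integral_mult_right)
      ultimately show ?thesis by (simp only:)
    qed
    have "\<bar>LBINT t:{0..}. ?e t\<bar> \<le> (LBINT t:{0..}. \<bar>?e t\<bar>)"
      using set_integral_norm_bound[OF ie] unfolding real_norm_def .
    also have "\<dots> \<le> (LBINT t:{0..}. (u - s)\<^sup>2 * \<bar>t ^ Suc (Suc j) * exp (- (s/2) * t) * f t\<bar>)"
    proof (rule set_integral_mono)
      show "set_integrable lborel {0..} (\<lambda>t. \<bar>?e t\<bar>)" using ie by (rule set_integrable_abs)
      show "set_integrable lborel {0..} (\<lambda>t. (u - s)\<^sup>2 * \<bar>t ^ Suc (Suc j) * exp (- (s/2) * t) * f t\<bar>)"
        using int[of "s/2" "Suc (Suc j)"] s by (intro set_integrable_mult_right set_integrable_abs) auto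
      fix t :: real assume "t \<in> {0..}"
      then have t: "0 \<le> t" by simp
      let ?E = "exp (- u * t) - exp (- s * t) + (u - s) * t * exp (- s * t)"
      have "\<bar>exp (- u * t) - exp (- s * t) - (- u * t - - s * t) * exp (- s * t)\<bar>
          \<le> (- u * t - - s * t)\<^sup>2 * exp (- (s/2) * t)"
        using t u s mult_right_mono[of "s/2" u t] mult_right_mono[of "s/2" s t]
        by (intro exp_first_order_error) auto
      then have E: "\<bar>?E\<bar> \<le> (u - s)\<^sup>2 * t\<^sup>2 * exp (- (s/2) * t)"
        by (simp add: algebra_simps power2_eq_square)
      have "?e t = (t ^ j * f t) * ?E"
        by (simp add: algebra_simps)
      then have "\<bar>?e t\<bar> = \<bar>t ^ j * f t\<bar> * \<bar>?E\<bar>"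
        by (simp only: abs_mult)
      also have "\<dots> \<le> \<bar>t ^ j * f t\<bar> * ((u - s)\<^sup>2 * t\<^sup>2 * exp (- (s/2) * t))"
        using E by (rule mult_left_mono) simp
      also have "\<dots> = (u - s)\<^sup>2 * \<bar>t ^ Suc (Suc j) * exp (- (s/2) * t) * f t\<bar>"
        by (simp add: abs_mult power2_eq_square mult_ac)
      finally show "\<bar>?e t\<bar> \<le> (u - s)\<^sup>2 * \<bar>t ^ Suc (Suc j) * exp (- (s/2) * t) * f t\<bar>" .
    qed
    also have "\<dots> = (u - s)\<^sup>2 * K" unfolding K_def by simp
    finally show ?thesis unfolding e_eq .
  qed
  let ?q = "\<lambda>u. (laplace_moment f j u - laplace_moment f j s) / (u - s) - - laplace_moment f (Suc j) s"
  have "(?q \<longlongrightarrow> 0) (at s)"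
  proof (rule Lim_null_comparison)
    show "\<forall>\<^sub>F u in at s. norm (?q u) \<le> \<bar>u - s\<bar> * K"
    proof -
      have "\<forall>\<^sub>F u in at s. s/2 < u"
        using s by (intro order_tendstoD[OF tendsto_ident_at]) auto
      moreover have "\<forall>\<^sub>F u in at s. u \<noteq> s" by (simp add: eventually_at_filter)
      ultimately show ?thesis
      proof eventually_elim
        case (elim u)
        have "?q u = (laplace_moment f j u - laplace_moment f j s + (u - s) * laplace_moment f (Suc j) s) / (u - s)"
          using elim(2) by (simp add: add_divide_distrib)
        then have "norm (?q u) \<le> (u - s)\<^sup>2 * K / \<bar>u - s\<bar>"
          using bound[OF elim(1)] elim(2) by (simp add: divide_right_mono)
        also have "(u - s)\<^sup>2 * K / \<bar>u - s\<bar> = \<bar>u - s\<bar> * K"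
        proof -
          have "(u - s)\<^sup>2 = \<bar>u - s\<bar> * \<bar>u - s\<bar>" by (simp add: power2_eq_square)
          then have "(u - s)\<^sup>2 * K / \<bar>u - s\<bar> = \<bar>u - s\<bar> * (\<bar>u - s\<bar> * K) / \<bar>u - s\<bar>"
            by (simp only: mult.assoc)
          also have "\<dots> = \<bar>u - s\<bar> * K"
            using elim(2) by (intro nonzero_mult_div_cancel_left) simp
          finally show ?thesis .
        qed
        finally show ?case .
      qed
    qed
    have "((\<lambda>u. \<bar>u - s\<bar> * K) \<longlongrightarrow> \<bar>s - s\<bar> * K) (at s)" by (intro tendsto_intros)
    then show "((\<lambda>u. \<bar>u - s\<bar> * K) \<longlongrightarrow> 0) (at s)" by simp
  qed
  then show ?thesis
    unfolding has_field_derivative_iff by (rule LIM_zero_cancel)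
qed

text \<open>
  The hypothesis on \<open>\<phi>\<close> determines its iterated derivatives on the positive half-line because
  that half-line is open.
\<close>
lemma laplace_higher_deriv:
  assumes f: "\<And>s. 0 < s \<Longrightarrow> set_integrable lborel {0..} (\<lambda>t. exp (- s * t) * f t)"
    and \<phi>: "\<And>s. 0 < s \<Longrightarrow> \<phi> s = (LBINT t:{0..}. exp (- s * t) * f t)"
    and s: "0 < s"
  shows "(deriv ^^ j) \<phi> s = (-1) ^ j * laplace_moment f j s"
    and "(deriv ^^ j) \<phi> differentiable (at s)"
proof -
  have deriv: "((deriv ^^ j) \<phi> has_real_derivative (-1) ^ Suc j * laplace_moment f (Suc j) u) (at u)"
    if eq: "\<And>v. 0 < v \<Longrightarrow> (deriv ^^ j) \<phi> v = (-1) ^ j * laplace_moment f j v" and u: "0 < u" for j u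
  proof (rule has_field_derivative_transform_within_open)
    show "((\<lambda>v. (-1) ^ j * laplace_moment f j v) has_real_derivative (-1) ^ Suc j * laplace_moment f (Suc j) u) (at u)"
    proof -
      have "(laplace_moment f j has_real_derivative - laplace_moment f (Suc j) u) (at u)"
        using f u by (rule laplace_moment_deriv)
      from DERIV_cmult[OF this, of "(-1) ^ j"] show ?thesis by simp
    qed
    show "open {0::real<..}" "u \<in> {0<..}" using u by auto
  qed (use eq in auto)
  have eq: "(deriv ^^ j) \<phi> u = (-1) ^ j * laplace_moment f j u" if "0 < u" for j u
    using that
  proof (induction j arbitrary: u)
    case 0
    then show ?case by (simp add: \<phi> laplace_moment_def)
  next
    case (Suc j)
    from Suc.IH Suc.prems
    have "((deriv ^^ j) \<phi> has_real_derivative (-1) ^ Suc j * laplace_moment f (Suc j) u) (at u)"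
      by (rule deriv)
    then show ?case by (simp add: DERIV_imp_deriv)
  qed
  show "(deriv ^^ j) \<phi> s = (-1) ^ j * laplace_moment f j s" using eq s .
  have "((deriv ^^ j) \<phi> has_real_derivative (-1) ^ Suc j * laplace_moment f (Suc j) s) (at s)"
    using eq s by (rule deriv)
  then show "(deriv ^^ j) \<phi> differentiable (at s)"
    unfolding real_differentiable_def by (rule exI)
qed

section \<open>Post-Widder inversion for Lipschitz functions\<close>

text \<open>
  The mean of a Lipschitz function differs from its value at the expectation \<open>\<mu>\<close> by at most
  \<open>L\<close> times the standard deviation \<open>\<delta>\<close>. Replacing \<open>\<bar>x - \<mu>\<bar>\<close> by the bound \<open>(\<delta> + (x - \<mu>)\<^sup>2 / \<delta>) / 2\<close>
  (arithmetic-geometric mean inequality) makes the dominating function quadratic, so that its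
  integral is given by the moments up to order 2.
\<close>
lemma erlang_average_lipschitz:
  fixes f :: "real \<Rightarrow> real" and l :: real and k :: nat
  assumes lip: "L-lipschitz_on {0..} f" and l: "0 < l"
  defines "\<mu> \<equiv> real (Suc k) / l"
  assumes int: "integrable lborel (\<lambda>x. erlang_density k l x * f x)"
  shows "\<bar>(LBINT x. erlang_density k l x * f x) - f \<mu>\<bar> \<le> L * (sqrt (real (Suc k)) / l)"
proof -
  let ?p = "erlang_density k l"
  define \<delta> where "\<delta> = sqrt (real (Suc k)) / l"
  have \<delta>: "0 < \<delta>" using l by (simp add: \<delta>_def)
  have \<mu>: "0 \<le> \<mu>" using l by (simp add: \<mu>_def)
  have L: "0 \<le> L" using lip by (rule lipschitz_on_nonneg)
  note moment = erlang_density_moment[OF l, of k]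
  have m0: "has_bochner_integral lborel ?p 1" using moment[of 0] by simp
  have m1: "has_bochner_integral lborel (\<lambda>x. ?p x * x) \<mu>"
    using moment[of 1] by (simp add: \<mu>_def)
  have m2: "has_bochner_integral lborel (\<lambda>x. ?p x * x\<^sup>2) (\<mu>\<^sup>2 + \<delta>\<^sup>2)"
  proof -
    have "fact (k + 2) / (fact k * l\<^sup>2) = \<mu>\<^sup>2 + \<delta>\<^sup>2"
    proof -
      have "fact (k + 2) = ((real (Suc k))\<^sup>2 + real (Suc k)) * fact k"
        by (simp add: power2_eq_square algebra_simps)
      then have "fact (k + 2) / (fact k * l\<^sup>2) = ((real (Suc k))\<^sup>2 + real (Suc k)) / l\<^sup>2" by simp
      also have "\<dots> = \<mu>\<^sup>2 + \<delta>\<^sup>2"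
        by (simp add: \<mu>_def \<delta>_def power_divide flip: add_divide_distrib)
      finally show ?thesis .
    qed
    then show ?thesis using moment[of 2] by simp
  qed
  have "has_bochner_integral lborel
      (\<lambda>x. L / 2 * (\<delta> * ?p x + 1 / \<delta> * (?p x * x\<^sup>2 - 2 * \<mu> * (?p x * x) + \<mu>\<^sup>2 * ?p x)))
      (L / 2 * (\<delta> * 1 + 1 / \<delta> * (\<mu>\<^sup>2 + \<delta>\<^sup>2 - 2 * \<mu> * \<mu> + \<mu>\<^sup>2 * 1)))"
    by (intro has_bochner_integral_mult_right has_bochner_integral_add has_bochner_integral_diff m0 m1 m2)
  moreover have "L / 2 * (\<delta> * 1 + 1 / \<delta> * (\<mu>\<^sup>2 + \<delta>\<^sup>2 - 2 * \<mu> * \<mu> + \<mu>\<^sup>2 * 1)) = L * \<delta>"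
    using \<delta> by (simp add: power2_eq_square)
  ultimately have dom: "has_bochner_integral lborel
      (\<lambda>x. L / 2 * (\<delta> * ?p x + 1 / \<delta> * (?p x * x\<^sup>2 - 2 * \<mu> * (?p x * x) + \<mu>\<^sup>2 * ?p x))) (L * \<delta>)"
    by (simp only:)
  have i1: "integrable lborel (\<lambda>x. ?p x * f x - ?p x * f \<mu>)"
    using int m0 by (auto simp: has_bochner_integral_iff)
  have diff_eq: "(LBINT x. ?p x * f x) - f \<mu> = (LBINT x. ?p x * f x - ?p x * f \<mu>)"
    using int m0 by (simp add: has_bochner_integral_iff)
  have "\<bar>LBINT x. ?p x * f x - ?p x * f \<mu>\<bar> \<le> (LBINT x. \<bar>?p x * f x - ?p x * f \<mu>\<bar>)" by (rule integral_abs_bound)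
  also have "\<dots> \<le> (LBINT x. L / 2 * (\<delta> * ?p x + 1 / \<delta> * (?p x * x\<^sup>2 - 2 * \<mu> * (?p x * x) + \<mu>\<^sup>2 * ?p x)))"
  proof (rule integral_mono)
    show "integrable lborel (\<lambda>x. \<bar>?p x * f x - ?p x * f \<mu>\<bar>)" using i1 by (rule integrable_abs)
    show "integrable lborel (\<lambda>x. L / 2 * (\<delta> * ?p x + 1 / \<delta> * (?p x * x\<^sup>2 - 2 * \<mu> * (?p x * x) + \<mu>\<^sup>2 * ?p x)))"
      using dom by (simp add: has_bochner_integral_iff)
    fix x
    have p: "0 \<le> ?p x" using l by simp
    show "\<bar>?p x * f x - ?p x * f \<mu>\<bar> \<le> L / 2 * (\<delta> * ?p x + 1 / \<delta> * (?p x * x\<^sup>2 - 2 * \<mu> * (?p x * x) + \<mu>\<^sup>2 * ?p x))"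
    proof (cases "x < 0")
      case True
      then show ?thesis by (simp add: erlang_density_def)
    next
      case False
      have "\<bar>f x - f \<mu>\<bar> \<le> L * \<bar>x - \<mu>\<bar>"
        using lipschitz_onD[OF lip, of x \<mu>] False \<mu> by (simp add: dist_real_def)
      also have "\<dots> \<le> L * ((\<delta> + (x - \<mu>)\<^sup>2 / \<delta>) / 2)"
      proof -
        have "0 \<le> (\<bar>x - \<mu>\<bar> - \<delta>)\<^sup>2" by simp
        then have "2 * \<delta> * \<bar>x - \<mu>\<bar> \<le> \<delta>\<^sup>2 + (x - \<mu>)\<^sup>2" by (simp add: power2_diff algebra_simps)
        then have "\<bar>x - \<mu>\<bar> \<le> (\<delta> + (x - \<mu>)\<^sup>2 / \<delta>) / 2"
          using \<delta> by (simp add: field_simps power2_eq_square)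
        then show ?thesis using L by (rule mult_left_mono)
      qed
      finally have "?p x * \<bar>f x - f \<mu>\<bar> \<le> ?p x * (L * ((\<delta> + (x - \<mu>)\<^sup>2 / \<delta>) / 2))"
        using p by (rule mult_left_mono)
      moreover have "\<bar>?p x * f x - ?p x * f \<mu>\<bar> = ?p x * \<bar>f x - f \<mu>\<bar>"
        using p by (simp add: abs_mult flip: right_diff_distrib)
      moreover have "?p x * (L * ((\<delta> + (x - \<mu>)\<^sup>2 / \<delta>) / 2))
          = L / 2 * (\<delta> * ?p x + 1 / \<delta> * (?p x * x\<^sup>2 - 2 * \<mu> * (?p x * x) + \<mu>\<^sup>2 * ?p x))"
        using \<delta> by (simp add: field_simps power2_eq_square)
      ultimately show ?thesis by (simp only:)
    qed
  qed
  also have "\<dots> = L * \<delta>" using dom by (simp add: has_bochner_integral_iff)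
  finally show ?thesis unfolding diff_eq \<delta>_def .
qed

text \<open>
  Bernstein's theorem for Laplace transforms of Lipschitz functions. Each signed derivative is a
  moment of \<open>f\<close> and, up to a positive factor, an Erlang mean of \<open>f\<close>; these means converge to the
  values of \<open>f\<close>.
\<close>
theorem completely_monotonic_laplace_iff:
  assumes f: "\<And>s. 0 < s \<Longrightarrow> set_integrable lborel {0..} (\<lambda>t. exp (- s * t) * f t)"
    and \<phi>: "\<And>s. 0 < s \<Longrightarrow> \<phi> s = (LBINT t:{0..}. exp (- s * t) * f t)"
    and lip: "L-lipschitz_on {0..} f"
  shows "completely_monotonic \<phi> \<longleftrightarrow> (\<forall>t>0. 0 \<le> f t)"
proof -
  have hd: "(deriv ^^ j) \<phi> s = (-1) ^ j * laplace_moment f j s" if "0 < s" for j s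
    using f \<phi> that by (rule laplace_higher_deriv(1))
  have hdiff: "(deriv ^^ j) \<phi> differentiable (at s)" if "0 < s" for j s
    using f \<phi> that by (rule laplace_higher_deriv(2))
  have sign_cancel: "(-1) ^ j * ((-1) ^ j * x) = x" for j and x :: real
    by (cases "even j") auto
  show ?thesis
  proof
    assume pos: "\<forall>t>0. 0 \<le> f t"
    have "0 \<le> laplace_moment f j s" for j s
      unfolding laplace_moment_def set_lebesgue_integral_def
    proof (rule integral_nonneg_AE)
      \<comment> \<open>The assumption gives the sign of \<open>f\<close> outside the null set \<open>{0}\<close>.\<close>
      have "AE t in lborel. t \<noteq> (0::real)" by (rule AE_lborel_singleton)
      then show "AE t in lborel. 0 \<le> indicator {0..} t *\<^sub>R (t ^ j * exp (- s * t) * f t)"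
        by eventually_elim (use pos in \<open>auto simp: indicator_def\<close>)
    qed
    then show "completely_monotonic \<phi>"
      unfolding completely_monotonic_def by (simp add: hd hdiff sign_cancel)
  next
    assume cm: "completely_monotonic \<phi>"
    show "\<forall>t>0. 0 \<le> f t"
    proof (intro allI impI)
      fix t :: real assume t: "0 < t"
      have lower: "- (L * t / sqrt (real (Suc k))) \<le> f t" for k
      proof -
        \<comment> \<open>the rate for which the Erlang distribution of shape \<open>k + 1\<close> has mean \<open>t\<close>\<close>
        define l where "l = real (Suc k) / t"
        have l: "0 < l" using t by (simp add: l_def)
        have \<mu>: "real (Suc k) / l = t" using t by (simp add: l_def)
        have "0 \<le> (-1) ^ k * (deriv ^^ k) \<phi> l"
          using cm l unfolding completely_monotonic_def by blast
        then have mom: "0 \<le> laplace_moment f k l"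
          using l by (simp add: hd sign_cancel)
        have eq: "erlang_density k l x * f x
            = l ^ Suc k / fact k * (indicator {0..} x *\<^sub>R (x ^ k * exp (- l * x) * f x))" for x
          by (simp add: erlang_density_def indicator_def)
        have "set_integrable lborel {0..} (\<lambda>x. x ^ k * exp (- l * x) * f x)"
          using f l by (rule laplace_moment_integrable)
        then have int: "integrable lborel (\<lambda>x. erlang_density k l x * f x)"
          unfolding eq set_integrable_def by (rule integrable_mult_right)
        have "(LBINT x. erlang_density k l x * f x) = l ^ Suc k / fact k * laplace_moment f k l"
          unfolding eq laplace_moment_def set_lebesgue_integral_def by (rule integral_mult_right_zero)
        then have "0 \<le> (LBINT x. erlang_density k l x * f x)"
          using mom l by simp
        moreover have "\<bar>(LBINT x. erlang_density k l x * f x) - f t\<bar> \<le> L * (sqrt (real (Suc k)) / l)"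
          using erlang_average_lipschitz[OF lip l int] unfolding \<mu> .
        moreover have "L * (sqrt (real (Suc k)) / l) = L * t / sqrt (real (Suc k))"
          using t by (simp add: l_def field_simps)
        ultimately show ?thesis by linarith
      qed
      have "((\<lambda>k. - (L * t / sqrt (real (Suc k)))) \<longlonglongrightarrow> - 0)"
        by (intro tendsto_minus tendsto_divide_0[OF tendsto_const] filterlim_at_top_imp_at_infinity
              filterlim_compose[OF sqrt_at_top]
              filterlim_compose[OF filterlim_real_sequentially filterlim_Suc])
      then show "0 \<le> f t"
        using lower by (intro LIMSEQ_le_const2[where a="f t" and x=0 and X="\<lambda>k. - (L * t / sqrt (real (Suc k)))"]) auto
    qed
  qed
qed

section \<open>Sums of hinges and weak supermajorization\<close>

lemma hinge_eq_max: "(t - c) * indicator {c..} t = max 0 (t - c)" for t c :: real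
  by (auto simp: indicator_def)

lemma rho_fun_lipschitz: "(2 * real n)-lipschitz_on X (rho_fun n a b)"
proof (rule lipschitz_onI)
  fix t u
  have 1: "dist (\<Sum>k=1..n. max 0 (t - x k)) (\<Sum>k=1..n. max 0 (u - x k)) \<le> real n * dist t u" for x :: "nat \<Rightarrow> real"
  proof -
    have "\<bar>\<Sum>k=1..n. max 0 (t - x k) - max 0 (u - x k)\<bar> \<le> (\<Sum>k=1..n. \<bar>t - u\<bar>)"
      by (rule order_trans[OF sum_abs sum_mono]) auto
    then show ?thesis by (simp add: dist_real_def sum_subtractf)
  qed
  show "dist (rho_fun n a b t) (rho_fun n a b u) \<le> 2 * real n * dist t u"
    using 1[of a] 1[of b] unfolding rho_fun_def hinge_eq_max dist_real_def by linarith
qed simp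

lemma prefix_sum_le_hinge_sum:
  fixes x :: "nat \<Rightarrow> real"
  assumes "m \<le> n"
  shows "(\<Sum>k=1..m. t - x k) \<le> (\<Sum>k=1..n. max 0 (t - x k))"
proof -
  have "(\<Sum>k=1..m. t - x k) \<le> (\<Sum>k=1..m. max 0 (t - x k))" by (intro sum_mono) auto
  also have "\<dots> \<le> (\<Sum>k=1..n. max 0 (t - x k))" using assms by (intro sum_mono2) auto
  finally show ?thesis .
qed

lemma hinge_sum_eq_prefix_sum:
  fixes x :: "nat \<Rightarrow> real"
  assumes "m \<le> n" "\<And>k. k \<in> {1..m} \<Longrightarrow> x k \<le> t" "\<And>k. k \<in> {Suc m..n} \<Longrightarrow> t \<le> x k"
  shows "(\<Sum>k=1..n. max 0 (t - x k)) = (\<Sum>k=1..m. t - x k)"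
proof -
  have "(\<Sum>k=1..m. max 0 (t - x k)) = (\<Sum>k=1..n. max 0 (t - x k))"
    using assms by (intro sum.mono_neutral_left) auto
  moreover have "(\<Sum>k=1..m. max 0 (t - x k)) = (\<Sum>k=1..m. t - x k)"
    using assms by (intro sum.cong) auto
  ultimately show ?thesis by simp
qed

lemma sorted_prefix_below:
  fixes x :: "nat \<Rightarrow> real"
  assumes "mono_on {1..n} x"
  obtains m where "m \<le> n" "\<And>k. k \<in> {1..m} \<Longrightarrow> x k \<le> t" "\<And>k. k \<in> {Suc m..n} \<Longrightarrow> t \<le> x k"
proof
  define S where "S = insert 0 {k \<in> {1..n}. x k \<le> t}"
  define m where "m = Max S"
  have fin: "finite S" by (simp add: S_def)
  have "m \<in> S" unfolding m_def using fin by (rule Max_in) (simp add: S_def)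
  then have m: "m = 0 \<or> m \<in> {1..n} \<and> x m \<le> t" by (simp add: S_def)
  then show "m \<le> n" by auto
  show "x k \<le> t" if k: "k \<in> {1..m}" for k
  proof -
    have "m \<in> {1..n}" "x m \<le> t" using k m by auto
    moreover have "x k \<le> x m" using k \<open>m \<in> {1..n}\<close> by (intro mono_onD[OF assms]) auto
    ultimately show ?thesis by simp
  qed
  show "t \<le> x k" if k: "k \<in> {Suc m..n}" for k
  proof (rule ccontr)
    assume "\<not> t \<le> x k"
    then have "k \<in> S" using k by (auto simp: S_def)
    then have "k \<le> m" unfolding m_def using fin by (rule Max_ge[rotated])
    then show False using k by simp
  qed
qed

text \<open>
  Each direction bounds the hinge sum of one sequence below by a prefix sum, and evaluates the
  hinge sum of the other one as the prefix sum of the same length: given \<open>m\<close>,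
  this is possible for \<open>a\<close> at \<open>t = a\<^sub>m\<close>, where the hinges of all later entries vanish; given \<open>t\<close>, it is
  possible for \<open>b\<close> with \<open>m\<close> the place where \<open>b\<close> passes \<open>t\<close>.
\<close>
lemma rho_fun_nonneg_iff:
  assumes a: "mono_on {1..n} a" and b: "mono_on {1..n} b"
  shows "(\<forall>t. 0 \<le> rho_fun n a b t) \<longleftrightarrow> weakly_supermajorized n b a"
proof
  assume rho: "\<forall>t. 0 \<le> rho_fun n a b t"
  show "weakly_supermajorized n b a"
    unfolding weakly_supermajorized_def
  proof
    fix m assume m: "m \<in> {1..n}"
    have "(\<Sum>k=1..m. a m - b k) \<le> (\<Sum>k=1..n. max 0 (a m - b k))"
      using m by (intro prefix_sum_le_hinge_sum) auto
    also have "\<dots> \<le> (\<Sum>k=1..n. max 0 (a m - a k))"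
      using rho unfolding rho_fun_def hinge_eq_max by simp
    also have "\<dots> = (\<Sum>k=1..m. a m - a k)"
      using m by (intro hinge_sum_eq_prefix_sum mono_onD[OF a]) auto
    finally show "(\<Sum>k=1..m. a k) \<le> (\<Sum>k=1..m. b k)" by (simp add: sum_subtractf)
  qed
next
  assume maj: "weakly_supermajorized n b a"
  show "\<forall>t. 0 \<le> rho_fun n a b t"
  proof
    fix t
    obtain m where m: "m \<le> n" "\<And>k. k \<in> {1..m} \<Longrightarrow> b k \<le> t" "\<And>k. k \<in> {Suc m..n} \<Longrightarrow> t \<le> b k"
      using sorted_prefix_below[OF b, of t] by metis
    have "(\<Sum>k=1..n. max 0 (t - b k)) = (\<Sum>k=1..m. t - b k)"
      using m by (rule hinge_sum_eq_prefix_sum)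
    also have "\<dots> \<le> (\<Sum>k=1..m. t - a k)"
    proof (cases "m = 0")
      case False
      then have "(\<Sum>k=1..m. a k) \<le> (\<Sum>k=1..m. b k)"
        using maj m(1) unfolding weakly_supermajorized_def by auto
      then show ?thesis by (simp add: sum_subtractf)
    qed simp
    also have "\<dots> \<le> (\<Sum>k=1..n. max 0 (t - a k))"
      using m(1) by (rule prefix_sum_le_hinge_sum)
    finally show "0 \<le> rho_fun n a b t" unfolding rho_fun_def hinge_eq_max by simp
  qed
qed

lemma rho_fun_nonpos_arg:
  assumes "\<forall>k\<in>{1..n}. 0 \<le> a k" "\<forall>k\<in>{1..n}. 0 \<le> b k" "t \<le> 0"
  shows "rho_fun n a b t = 0"
proof -
  have "(\<Sum>k=1..n. max 0 (t - x k)) = 0" if "\<forall>k\<in>{1..n}. 0 \<le> x k" for x :: "nat \<Rightarrow> real"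
    using that assms(3) by (intro sum.neutral) force
  then show ?thesis using assms unfolding rho_fun_def hinge_eq_max by simp
qed

theorem lemma2p2:
  fixes n :: nat and a b :: "nat \<Rightarrow> real"
  assumes "\<forall>k\<in>{1..n}. 0 \<le> a k" and "mono_on {1..n} a"
    and "\<forall>k\<in>{1..n}. 0 \<le> b k" and "mono_on {1..n} b"
  shows "(\<forall>s>0. set_integrable lborel {0..} (\<lambda>t. exp (- s * t) * rho_fun n a b t) \<and>
             g_fun n a b s = (LBINT t:{0..}. exp (- s * t) * rho_fun n a b t)) \<and>
         (completely_monotonic (g_fun n a b) \<longleftrightarrow> (\<forall>t. rho_fun n a b t \<ge> 0)) \<and>
         ((\<forall>t. rho_fun n a b t \<ge> 0) \<longleftrightarrow> weakly_supermajorized n b a)"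
proof (intro conjI)
  have laplace: "set_integrable lborel {0..} (\<lambda>t. exp (- s * t) * rho_fun n a b t)"
    "g_fun n a b s = (LBINT t:{0..}. exp (- s * t) * rho_fun n a b t)" if "0 < s" for s
    using g_fun_has_laplace_integral[OF assms(1,3) that]
    by (simp_all add: has_bochner_integral_iff set_integrable_def set_lebesgue_integral_def)
  then show "\<forall>s>0. set_integrable lborel {0..} (\<lambda>t. exp (- s * t) * rho_fun n a b t) \<and>
             g_fun n a b s = (LBINT t:{0..}. exp (- s * t) * rho_fun n a b t)" by blast
  have "completely_monotonic (g_fun n a b) \<longleftrightarrow> (\<forall>t>0. 0 \<le> rho_fun n a b t)"
    using laplace rho_fun_lipschitz by (rule completely_monotonic_laplace_iff)
  also have "\<dots> \<longleftrightarrow> (\<forall>t. 0 \<le> rho_fun n a b t)"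
    using rho_fun_nonpos_arg[OF assms(1,3)] by (metis order.refl linorder_not_le)
  finally show "completely_monotonic (g_fun n a b) \<longleftrightarrow> (\<forall>t. rho_fun n a b t \<ge> 0)" .
  show "(\<forall>t. rho_fun n a b t \<ge> 0) \<longleftrightarrow> weakly_supermajorized n b a"
    using assms(2,4) by (rule rho_fun_nonneg_iff)
qed

end
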